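(* Let $\alpha>1$ and $r=\frac12(1-\frac1\alpha)$. Let $a,b$ be positive integers with $a\le b$ and $s=a+b\ge 2$, and let $n_*=\lfloor -\log_r a\rfloor+1$. Then for every positive even integer $k$ with \[ k\ \ge\ \max\Bigg\{\left\lceil 2\,\frac{(1-r+r^{n_*})^{a-1}\,[\,b(1-r+r^{n_*})+a\,]}{(1-r)^{a-1}(1-r^{n_*})^{b-1}\,[\,b(1-r)+a(1-r^{n_*})\,]}+2\right\rceil\cdot\Big(\frac{1-r}{r}\Big)^{a},\ \ 2\Big(\frac{1-r}{r}\Big)^{a+1},\ \ 2\Big(\frac{1}{1-r}\Big)^{s-1}+2\Bigg\}, \] we have \[ \Big[0,\tfrac k2\Big]=\{x_1^ax_2^b+x_3^ax_4^b+\cdots+x_{k-1}^ax_k^b:\ x_1,\dots,x_k\in C_\alpha\}. \]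
   Context: For real $\alpha>1$ let $r=\frac12(1-\frac1\alpha)\in(0,\frac12)$. Define $f_0,f_1:[0,1]\to[0,1]$ by $f_0(x)=rx$, $f_1(x)=rx+1-r$; for $\omega=\sigma_1\cdots\sigma_n\in\{0,1\}^n$ let $f_\omega=f_{\sigma_1}\circ\cdots\circ f_{\sigma_n}$. Let $F_n=\{f_\omega([0,1]):\omega\in\{0,1\}^n\}$ (the level-$n$ basic intervals, each of length $r^n$), $C_n=\bigcup_{I\in F_n}I$, and $C_\alpha=\bigcap_{n\ge1}C_n$ (the middle-$\frac1\alpha$ Cantor set; $C_3$ is the ternary Cantor set). *)

theory Defs
  imports "HOL-Analysis.Analysis"
begin

text \<open>Contraction ratio r = (1 - 1/alpha)/2 of the middle-1/alpha Cantor set.\<close>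
definition cantor_ratio :: "real \<Rightarrow> real" where
  "cantor_ratio \<alpha> = (1 - 1 / \<alpha>) / 2"

definition cmap :: "real \<Rightarrow> bool \<Rightarrow> real \<Rightarrow> real" where
  "cmap r \<sigma> x = (if \<sigma> then r * x + 1 - r else r * x)"

definition cword :: "real \<Rightarrow> bool list \<Rightarrow> real \<Rightarrow> real" where
  "cword r \<omega> = foldr (\<lambda>\<sigma> g. cmap r \<sigma> \<circ> g) \<omega> id"

definition basic_intervals :: "real \<Rightarrow> nat \<Rightarrow> real set set" where
  "basic_intervals r n = {cword r \<omega> ` {0..1} | \<omega>. length \<omega> = n}"

definition cantor_level :: "real \<Rightarrow> nat \<Rightarrow> real set" where
  "cantor_level r n = \<Union> (basic_intervals r n)"

definition cantor_set :: "real \<Rightarrow> real set" where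
  "cantor_set \<alpha> = (\<Inter>n\<in>{1..}. cantor_level (cantor_ratio \<alpha>) n)"

end

(*
  Along the diagonal of a product of two basic intervals [c, c + q] and [1 - q, 1], the value
  x^a y^b depends on one point e of the Cantor set, with slope a x^(a-1) y^b + b x^a y^(b-1) times q.
  A sum of such functions of independent Cantor points takes every value between its extremes
  as soon as r times the sum of the slopes of all but one summand dominates (1 - 2 r) times the slope of
  the remaining one: passing from level n to level n + 1, the summands move one at a time from the
  left to the right subinterval, and the width of all others bridges the jump.

  Writing K = (1 - 2 r) / r and Q for the ratio of the extreme slopes on [1 - r, 1 - r + q] x [1 - q, 1],
  this applies to j equal boxes, the other pairs being zero, once j >= K Q + 1. Letting j and c vary
  covers everything above (K Q + 2) (1 - r)^a (1 - q)^b. Since the sums are stable under multiplication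
  by r^a, it remains to reach r^a m from there, where m = k / 2. For r >= 9/25 nothing is left. For smaller r and
  a >= 2, p pairs are frozen at (1 - r, 1) and the others are scaled by r^a. For a = 1 the otherwise
  vanishing pairs use x in [0, r], where the slope in x does not degenerate.
*)
theory Submission
  imports Defs
begin

section \<open>Auxiliary facts on sets of reals\<close>

lemma compact_sumset:
  fixes A :: "nat \<Rightarrow> real set"
  assumes "\<And>i. i < N \<Longrightarrow> compact (A i)"
  shows "compact {\<Sum>i<N. v i | v. \<forall>i<N. v i \<in> A i}"
  using assms
proof (induction N)
  case 0
  then show ?case by simp
next
  case (Suc N)
  have "{\<Sum>i<Suc N. v i | v. \<forall>i<Suc N. v i \<in> A i} =
      {x + y | x y. x \<in> {\<Sum>i<N. v i | v. \<forall>i<N. v i \<in> A i} \<and> y \<in> A N}" (is "?L = ?R")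
  proof
    show "?L \<subseteq> ?R"
    proof
      fix s assume "s \<in> ?L"
      then obtain v where v: "\<forall>i<Suc N. v i \<in> A i" "s = (\<Sum>i<N. v i) + v N"
        by auto
      show "s \<in> ?R" using v by (intro CollectI exI[of _ "\<Sum>i<N. v i"] exI[of _ "v N"]) auto
    qed
    show "?R \<subseteq> ?L"
    proof
      fix s assume "s \<in> ?R"
      then obtain v y where v: "\<forall>i<N. v i \<in> A i" "y \<in> A N" "s = (\<Sum>i<N. v i) + y"
        by blast
      show "s \<in> ?L"
        using v by (intro CollectI exI[of _ "v(N := y)"]) (auto simp: less_Suc_eq)
    qed
  qed
  moreover have "compact ?R"
    using Suc by (intro compact_sums) auto
  ultimately show ?case by simp
qed

text \<open>The least \<open>p\<close> with \<open>t \<le> H p\<close> works: either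
  \<open>p = 0\<close>, or \<open>L p \<le> H (p - 1) < t\<close>.\<close>

lemma interval_chain:
  fixes L H :: "nat \<Rightarrow> real"
  assumes "L 0 \<le> t" "t \<le> H N" and "\<And>p. p < N \<Longrightarrow> L (Suc p) \<le> H p"
  shows "\<exists>p\<le>N. L p \<le> t \<and> t \<le> H p"
  using assms
proof (induction N)
  case (Suc N)
  show ?case
  proof (cases "t \<le> H N")
    case True
    then show ?thesis using Suc.IH[OF Suc.prems(1) True] Suc.prems(3) le_SucI by (metis less_SucI)
  next
    case False
    then have "L (Suc N) \<le> t" using Suc.prems(3)[of N] by simp
    then show ?thesis using Suc.prems(2) by blast
  qed
qed auto

text \<open>If u lies below \<open>l * m\<close>, then u / l is covered already and scaling brings
  it back to u. Each such round lowers the left end by a factor l, so every positive t is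
  reached.\<close>

lemma Icc_subset_of_scaling:
  fixes S :: "real set"
  assumes l: "0 < l" "l < 1" and "0 \<in> S"
    and scale: "\<And>t. t \<in> S \<Longrightarrow> l * t \<in> S" and top: "{l * m..m} \<subseteq> S"
  shows "{0..m} \<subseteq> S"
proof
  fix t assume t: "t \<in> {0..m}"
  have step: "{l ^ n * m..m} \<subseteq> S" for n
  proof (induction n)
    case 0
    have "m \<in> S" if "0 \<le> m" using that top l by (auto simp: mult_left_le_one_le)
    then show ?case using t by auto
  next
    case (Suc n)
    show ?case
    proof
      fix u assume u: "u \<in> {l ^ Suc n * m..m}"
      show "u \<in> S"
      proof (cases "l * m \<le> u")
        case True
        then show ?thesis using top u by auto
      next
        case False
        then have "u / l \<in> {l ^ n * m..m}" using u l by (auto simp: field_simps)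
        then have "l * (u / l) \<in> S" using Suc scale by blast
        then show ?thesis using l by simp
      qed
    qed
  qed
  show "t \<in> S"
  proof (cases "t = 0")
    case False
    then have pos: "0 < t" "0 < m" using t by auto
    then obtain n where "l ^ n < t / m" using real_arch_pow_inv[of "t / m" l] l by auto
    then have "l ^ n * m \<le> t" using pos by (simp add: field_simps)
    then show ?thesis using step[of n] t by auto
  qed (use assms in auto)
qed

section \<open>Sums of functions of independent points of a self-similar set\<close>

locale self_similar_set =
  fixes r :: real and C :: "real set"
  assumes r_pos: "0 < r" and r_less_half: "r < 1 / 2"
    and C_subset: "C \<subseteq> {0..1}" and closed_C: "closed C"
    and zero_in_C: "0 \<in> C" and one_in_C: "1 \<in> C"
    and left_branch: "z \<in> C \<Longrightarrow> r * z \<in> C"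
    and right_branch: "z \<in> C \<Longrightarrow> r * z + 1 - r \<in> C"
begin

text \<open>These play the role of the left endpoints of the level-n basic intervals, described by
  the scaled copy of C that starts at c instead of by a word.\<close>

definition corners :: "nat \<Rightarrow> real set" where
  "corners n = {c. 0 \<le> c \<and> c + r ^ n \<le> 1 \<and> (\<forall>z\<in>C. c + r ^ n * z \<in> C)}"

lemma corners_subset: "corners n \<subseteq> C"
  using zero_in_C by (force simp: corners_def)

lemma cornersD:
  assumes "c \<in> corners n"
  shows "0 \<le> c" "c + r ^ n \<le> 1" "z \<in> C \<Longrightarrow> c + r ^ n * z \<in> C"
  using assms by (auto simp: corners_def)

lemma zero_in_corners_0: "0 \<in> corners 0"
  by (auto simp: corners_def)

lemma corners_refine_left:
  assumes "c \<in> corners n" shows "c \<in> corners (Suc n)"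
proof -
  have "r * r ^ n \<le> r ^ n" using r_pos r_less_half by (simp add: mult_left_le_one_le)
  moreover have "c + r * r ^ n * z \<in> C" if "z \<in> C" for z
    using cornersD(3)[OF assms left_branch[OF that]] by (simp add: mult_ac)
  ultimately show ?thesis using cornersD[OF assms] by (auto simp: corners_def)
qed

lemma corners_refine_right:
  assumes "c \<in> corners n" shows "c + r ^ n * (1 - r) \<in> corners (Suc n)"
proof -
  have "c + r ^ n * (1 - r) + r * r ^ n * z \<in> C" if "z \<in> C" for z
    using cornersD(3)[OF assms right_branch[OF that]] by (simp add: algebra_simps)
  moreover have "0 \<le> c + r ^ n * (1 - r)"
    using cornersD(1)[OF assms] r_pos r_less_half by (intro add_nonneg_nonneg mult_nonneg_nonneg) auto
  moreover have "c + r ^ n * (1 - r) + r ^ Suc n = c + r ^ n"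
    by (simp add: algebra_simps)
  ultimately show ?thesis using cornersD(2)[OF assms] by (simp add: corners_def)
qed

lemma corners_scale_left:
  assumes "c \<in> corners n" shows "r * c \<in> corners (Suc n)"
proof -
  have "r * c + r * r ^ n * z \<in> C" if "z \<in> C" for z
    using left_branch[OF cornersD(3)[OF assms that]] by (simp add: algebra_simps)
  moreover have "r * (c + r ^ n) \<le> r"
    using cornersD[OF assms] r_pos by simp
  ultimately show ?thesis using cornersD(1)[OF assms] r_pos r_less_half
    by (auto simp: corners_def algebra_simps)
qed

lemma corners_scale_right:
  assumes "c \<in> corners n" shows "1 - r + r * c \<in> corners (Suc n)"
proof -
  have "1 - r + r * c + r * r ^ n * z \<in> C" if "z \<in> C" for z
    using right_branch[OF cornersD(3)[OF assms that]] by (simp add: algebra_simps)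
  moreover have "r * (c + r ^ n) \<le> r"
    using cornersD[OF assms] r_pos by simp
  moreover have "0 \<le> 1 - r + r * c"
    using cornersD(1)[OF assms] r_pos r_less_half by (intro add_nonneg_nonneg mult_nonneg_nonneg) auto
  ultimately show ?thesis by (auto simp: corners_def algebra_simps)
qed

lemma last_corner: "1 - r ^ n \<in> corners n"
proof (induction n)
  case 0
  then show ?case using zero_in_corners_0 by simp
next
  case (Suc n)
  from corners_scale_right[OF this] show ?case by (simp add: algebra_simps)
qed

text \<open>The widest gap between basic intervals is the central one, of length 1 - 2 r; the gaps
  inside a branch are smaller by a factor r.\<close>

lemma ex_corner_near:
  assumes "0 \<le> z" "z \<le> 1"
  shows "\<exists>c\<in>corners n. c \<le> z \<and> z \<le> c + r ^ n + (1 - 2 * r)"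
  using assms
proof (induction n arbitrary: z)
  case 0
  then show ?case using zero_in_corners_0 r_less_half by (intro bexI[of _ 0]) auto
next
  case (Suc n)
  have gap: "r * (1 - 2 * r) \<le> 1 - 2 * r" using r_pos r_less_half by (simp add: mult_left_le_one_le)
  consider "z \<le> r" | "r < z" "z < 1 - r" | "1 - r \<le> z" by linarith
  then show ?case
  proof cases
    case 1
    then obtain c where c: "c \<in> corners n" "c \<le> z / r" "z / r \<le> c + r ^ n + (1 - 2 * r)"
      using Suc.IH[of "z / r"] Suc.prems r_pos by auto
    then have "r * c \<le> z" "z \<le> r * c + r * r ^ n + r * (1 - 2 * r)"
      using r_pos by (auto simp: field_simps)
    then show ?thesis using corners_scale_left[OF c(1)] gap by (intro bexI[of _ "r * c"]) auto
  next
    case 2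
    \<comment> \<open>In the central gap the last interval of the left branch is taken; it ends
      exactly at r.\<close>
    have "r * (1 - r ^ n) \<le> r" using r_pos by simp
    then show ?thesis using 2 corners_scale_left[OF last_corner[of n]]
      by (intro bexI[of _ "r * (1 - r ^ n)"]) (auto simp: algebra_simps)
  next
    case 3
    then obtain c where c: "c \<in> corners n" "c \<le> (z - (1 - r)) / r"
        "(z - (1 - r)) / r \<le> c + r ^ n + (1 - 2 * r)"
      using Suc.IH[of "(z - (1 - r)) / r"] Suc.prems r_pos by auto
    then have "1 - r + r * c \<le> z" "z \<le> 1 - r + r * c + r * r ^ n + r * (1 - 2 * r)"
      using r_pos by (auto simp: field_simps)
    then show ?thesis using corners_scale_right[OF c(1)] gap
      by (intro bexI[of _ "1 - r + r * c"]) auto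
  qed
qed

lemma compact_C: "compact C"
  using closed_C C_subset bounded_subset[OF bounded_closed_interval] by (auto simp: compact_eq_bounded_closed)

text \<open>At every level n a tuple of intervals is found whose lower and upper sums enclose t;
  compactness turns these approximations into an exact solution. The balance condition keeps the
  enclosure alive from one level to the next.\<close>

lemma sum_attained:
  fixes \<phi> :: "nat \<Rightarrow> real \<Rightarrow> real"
  assumes slope_ge: "\<And>i u v. i < N \<Longrightarrow> 0 \<le> u \<Longrightarrow> u \<le> v \<Longrightarrow> v \<le> 1 \<Longrightarrow> \<mu> i * (v - u) \<le> \<phi> i v - \<phi> i u"
    and slope_le: "\<And>i u v. i < N \<Longrightarrow> 0 \<le> u \<Longrightarrow> u \<le> v \<Longrightarrow> v \<le> 1 \<Longrightarrow> \<phi> i v - \<phi> i u \<le> M i * (v - u)"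
    and balance: "\<And>i. i < N \<Longrightarrow> (1 - 2 * r) * M i \<le> r * (sum \<mu> {..<N} - \<mu> i)"
    and cont: "\<And>i. i < N \<Longrightarrow> continuous_on C (\<phi> i)"
    and t: "(\<Sum>i<N. \<phi> i 0) \<le> t" "t \<le> (\<Sum>i<N. \<phi> i 1)"
  shows "\<exists>e. (\<forall>i<N. e i \<in> C) \<and> (\<Sum>i<N. \<phi> i (e i)) = t"
proof -
  have approx: "\<exists>e. (\<forall>i<N. e i \<in> corners n) \<and> (\<Sum>i<N. \<phi> i (e i)) \<le> t \<and>
      t \<le> (\<Sum>i<N. \<phi> i (e i + r ^ n))" for n
  proof (induction n)
    case 0
    then show ?case using t zero_in_corners_0 by (intro exI[of _ "\<lambda>_. 0"]) auto
  next
    case (Suc n)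
    then obtain e where e: "\<And>i. i < N \<Longrightarrow> e i \<in> corners n"
      and lo: "(\<Sum>i<N. \<phi> i (e i)) \<le> t" and hi: "t \<le> (\<Sum>i<N. \<phi> i (e i + r ^ n))"
      by blast
    \<comment> \<open>Stage p: the first p summands have moved to their right subinterval, the
      others sit in the left one. \<open>L p\<close> and \<open>H p\<close> are the lower and upper
      sums of that stage, and consecutive stages are shown to overlap.\<close>
    define d where "d p i = (if i < p then e i + r ^ n * (1 - r) else e i)" for p i :: nat
    have d: "d p i \<in> corners (Suc n)" if "i < N" for p i
      using corners_refine_left corners_refine_right e that by (auto simp: d_def)
    define L where "L p = (\<Sum>i<N. \<phi> i (d p i))" for p
    define H where "H p = (\<Sum>i<N. \<phi> i (d p i + r ^ Suc n))" for p
    have "L 0 \<le> t" using lo by (simp add: L_def d_def)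
    moreover have "t \<le> H N"
    proof -
      have "H N = (\<Sum>i<N. \<phi> i (e i + r ^ n))"
        unfolding H_def by (intro sum.cong) (auto simp: d_def algebra_simps)
      then show ?thesis using hi by simp
    qed
    moreover have "L (Suc p) \<le> H p" if p: "p < N" for p
    proof -
      define \<rho> where "\<rho> = r ^ n"
      have \<rho>: "0 < \<rho>" using r_pos by (simp add: \<rho>_def)
      \<comment> \<open>A summand other than p keeps its subinterval of length \<rho> r between the
        two stages, so its variation there helps to bridge the jump.\<close>
      have rest: "\<rho> * r * \<mu> i \<le> \<phi> i (d p i + r ^ Suc n) - \<phi> i (d (Suc p) i)"
        if "i \<in> {..<N} - {p}" for i
      proof -
        have "d (Suc p) i = d p i" using that by (auto simp: d_def)
        moreover have "\<mu> i * (d p i + r ^ Suc n - d p i) \<le> \<phi> i (d p i + r ^ Suc n) - \<phi> i (d p i)"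
          using that cornersD(1,2)[OF d[of i p]] r_pos by (intro slope_ge) auto
        ultimately show ?thesis by (simp add: \<rho>_def mult_ac)
      qed
      \<comment> \<open>Summand p jumps over the gap from the end of its left subinterval to the
        start of its right one, of length \<rho> (1 - 2 r).\<close>
      have "\<phi> p (e p + \<rho> * (1 - r)) - \<phi> p (e p + \<rho> * r) \<le>
          M p * (e p + \<rho> * (1 - r) - (e p + \<rho> * r))"
      proof (rule slope_le[OF p])
        show "0 \<le> e p + \<rho> * r" using cornersD(1)[OF e[OF p]] \<rho> r_pos by simp
        show "e p + \<rho> * r \<le> e p + \<rho> * (1 - r)" using \<rho> r_less_half by simp
        have "\<rho> * (1 - r) \<le> \<rho>" using \<rho> r_pos by simp
        then show "e p + \<rho> * (1 - r) \<le> 1" using cornersD(2)[OF e[OF p]] by (simp add: \<rho>_def)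
      qed
      moreover have "M p * (e p + \<rho> * (1 - r) - (e p + \<rho> * r)) = \<rho> * ((1 - 2 * r) * M p)"
        by (simp add: algebra_simps)
      moreover have "sum \<mu> {..<N} - \<mu> p = sum \<mu> ({..<N} - {p})"
        using p by (simp add: sum_diff1)
      then have "\<rho> * ((1 - 2 * r) * M p) \<le> \<rho> * (r * sum \<mu> ({..<N} - {p}))"
        using \<rho> balance[OF p] by simp
      ultimately have "\<phi> p (e p + \<rho> * (1 - r)) - \<phi> p (e p + \<rho> * r) \<le>
          \<rho> * (r * sum \<mu> ({..<N} - {p}))"
        by linarith
      then have own: "\<phi> p (e p + \<rho> * (1 - r)) - \<phi> p (e p + \<rho> * r) \<le>
          (\<Sum>i\<in>{..<N} - {p}. \<rho> * r * \<mu> i)"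
        by (simp add: sum_distrib_left mult_ac)
      have "H p - L (Suc p) = (\<Sum>i<N. \<phi> i (d p i + r ^ Suc n) - \<phi> i (d (Suc p) i))"
        by (simp add: H_def L_def sum_subtractf)
      also have "\<dots> = (\<phi> p (d p p + r ^ Suc n) - \<phi> p (d (Suc p) p)) +
          (\<Sum>i\<in>{..<N} - {p}. \<phi> i (d p i + r ^ Suc n) - \<phi> i (d (Suc p) i))"
        using p by (intro sum.remove) auto
      also have "\<phi> p (d p p + r ^ Suc n) - \<phi> p (d (Suc p) p) =
          \<phi> p (e p + \<rho> * r) - \<phi> p (e p + \<rho> * (1 - r))"
        by (simp add: d_def \<rho>_def mult_ac)
      finally have "H p - L (Suc p) = (\<phi> p (e p + \<rho> * r) - \<phi> p (e p + \<rho> * (1 - r))) +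
          (\<Sum>i\<in>{..<N} - {p}. \<phi> i (d p i + r ^ Suc n) - \<phi> i (d (Suc p) i))" .
      moreover have "(\<Sum>i\<in>{..<N} - {p}. \<rho> * r * \<mu> i) \<le>
          (\<Sum>i\<in>{..<N} - {p}. \<phi> i (d p i + r ^ Suc n) - \<phi> i (d (Suc p) i))"
        by (intro sum_mono rest)
      ultimately show ?thesis using own by linarith
    qed
    ultimately obtain p where "L p \<le> t" "t \<le> H p" using interval_chain[of L t H N] by blast
    then show ?case using d unfolding L_def H_def by blast
  qed
  \<comment> \<open>The tuples found at different levels need not be nested, so no limit of them is
    formed; instead t is a limit of attained sums, and the set of these is closed.\<close>
  let ?S = "{\<Sum>i<N. v i | v. \<forall>i<N. v i \<in> \<phi> i ` C}"
  have "closed ?S"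
    by (intro compact_imp_closed compact_sumset compact_continuous_image cont compact_C)
  moreover have "\<exists>s\<in>?S. dist s t < \<epsilon>" if "0 < \<epsilon>" for \<epsilon>
  proof -
    \<comment> \<open>B r^n bounds the distance between the lower and upper sums at level n; the
      divisor |B| + 1 is positive whatever B is.\<close>
    define B where "B = (\<Sum>i<N. M i)"
    have "0 < \<epsilon> / (\<bar>B\<bar> + 1)" using that by (intro divide_pos_pos) auto
    moreover have "r < 1" using r_less_half by simp
    ultimately obtain n where n: "r ^ n < \<epsilon> / (\<bar>B\<bar> + 1)"
      using real_arch_pow_inv by blast
    obtain e where e: "\<And>i. i < N \<Longrightarrow> e i \<in> corners n"
      and lo: "(\<Sum>i<N. \<phi> i (e i)) \<le> t" and hi: "t \<le> (\<Sum>i<N. \<phi> i (e i + r ^ n))"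
      using approx by blast
    have "(\<Sum>i<N. \<phi> i (e i + r ^ n)) - (\<Sum>i<N. \<phi> i (e i)) = (\<Sum>i<N. \<phi> i (e i + r ^ n) - \<phi> i (e i))"
      by (simp add: sum_subtractf)
    also have "\<dots> \<le> (\<Sum>i<N. M i * r ^ n)"
    proof (rule sum_mono)
      fix i assume "i \<in> {..<N}"
      then show "\<phi> i (e i + r ^ n) - \<phi> i (e i) \<le> M i * r ^ n"
        using slope_le[of i "e i" "e i + r ^ n"] cornersD(1,2)[OF e[of i]] r_pos by auto
    qed
    also have "\<dots> = B * r ^ n" by (simp add: B_def sum_distrib_right)
    also have "\<dots> \<le> (\<bar>B\<bar> + 1) * r ^ n" using r_pos by (intro mult_right_mono) auto
    also have "\<dots> < \<epsilon>" using n by (simp add: field_simps)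
    finally have "dist (\<Sum>i<N. \<phi> i (e i)) t < \<epsilon>" using lo hi by (simp add: dist_real_def)
    moreover have "(\<Sum>i<N. \<phi> i (e i)) \<in> ?S" using e corners_subset by blast
    ultimately show ?thesis by blast
  qed
  ultimately have "t \<in> ?S" using closure_approachable[of t ?S] closure_closed[of ?S] by blast
  then obtain v where v: "t = (\<Sum>i<N. v i)" "\<forall>i<N. v i \<in> \<phi> i ` C" by auto
  then have "\<forall>i. \<exists>e. i < N \<longrightarrow> e \<in> C \<and> v i = \<phi> i e" by blast
  then obtain e where "\<forall>i. i < N \<longrightarrow> e i \<in> C \<and> v i = \<phi> i (e i)" using choice by metis
  then show ?thesis using v(1) by (intro exI[of _ e]) auto
qed

end

section \<open>Sums of products x^a y^b over the set\<close>

lemma one_minus_power_times_le_one: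
  fixes q :: real
  assumes "0 \<le> q" "q \<le> 1"
  shows "(1 - q) ^ n * (1 + real n * q) \<le> 1"
proof -
  have "(1 - q) ^ n * (1 + real n * q) \<le> (1 - q) ^ n * (1 + q) ^ n"
    using Bernoulli_inequality[of q n] assms by (intro mult_left_mono) auto
  also have "\<dots> = ((1 - q) * (1 + q)) ^ n" by (simp add: power_mult_distrib)
  also have "\<dots> \<le> 1" using assms by (intro power_le_one) (auto simp: algebra_simps mult_le_one)
  finally show ?thesis .
qed


context self_similar_set
begin

definition prod_set :: "nat \<Rightarrow> nat \<Rightarrow> real set" where
  "prod_set a b = {x ^ a * y ^ b | x y. x \<in> C \<and> y \<in> C}"

definition sum_set :: "nat \<Rightarrow> nat \<Rightarrow> nat \<Rightarrow> real set" where
  "sum_set a b j = {\<Sum>i<j. v i | v. \<forall>i<j. v i \<in> prod_set a b}"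

lemma sum_setI:
  "(\<And>i. i < j \<Longrightarrow> v i \<in> prod_set a b) \<Longrightarrow> (\<Sum>i<j. v i) \<in> sum_set a b j"
  by (auto simp: sum_set_def)

lemma sum_set_add:
  assumes "s \<in> sum_set a b j" "t \<in> sum_set a b k"
  shows "s + t \<in> sum_set a b (j + k)"
proof -
  obtain v w where v: "\<forall>i<j. v i \<in> prod_set a b" "s = (\<Sum>i<j. v i)"
    and w: "\<forall>i<k. w i \<in> prod_set a b" "t = (\<Sum>i<k. w i)"
    using assms by (auto simp: sum_set_def)
  define u where "u i = (if i < j then v i else w (i - j))" for i
  have "(\<Sum>i<j + k. u i) = (\<Sum>i<j. u i) + (\<Sum>i<k. u (j + i))"
    by (induction k) (auto simp: add_ac)
  then have "(\<Sum>i<j + k. u i) = s + t" using v w by (simp add: u_def)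
  moreover have "(\<Sum>i<j + k. u i) \<in> sum_set a b (j + k)"
    using v w by (intro sum_setI) (auto simp: u_def)
  ultimately show ?thesis by simp
qed

lemma sum_set_replicate: "v \<in> prod_set a b \<Longrightarrow> real j * v \<in> sum_set a b j"
  using sum_setI[of j "\<lambda>_. v"] by simp

lemma zero_in_prod_set: "0 < a \<Longrightarrow> 0 \<in> prod_set a b"
  using zero_in_C unfolding prod_set_def by (intro CollectI exI[of _ 0]) auto

lemma sum_set_mono:
  assumes "0 < a" "j \<le> k" shows "sum_set a b j \<subseteq> sum_set a b k"
proof
  fix t assume "t \<in> sum_set a b j"
  then have "t + real (k - j) * 0 \<in> sum_set a b (j + (k - j))"
    by (intro sum_set_add sum_set_replicate zero_in_prod_set assms(1))
  then show "t \<in> sum_set a b k" using assms(2) by simp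
qed

text \<open>The left branch applied to every x multiplies each product by r^a.\<close>

lemma sum_set_scale:
  assumes "t \<in> sum_set a b j" shows "r ^ a * t \<in> sum_set a b j"
proof -
  obtain v where v: "\<forall>i<j. v i \<in> prod_set a b" "t = (\<Sum>i<j. v i)"
    using assms by (auto simp: sum_set_def)
  have "r ^ a * p \<in> prod_set a b" if "p \<in> prod_set a b" for p
    using that left_branch unfolding prod_set_def
    by (force simp: power_mult_distrib mult.assoc)
  then have "(\<Sum>i<j. r ^ a * v i) \<in> sum_set a b j" using v by (intro sum_setI) auto
  then show ?thesis using v by (simp add: sum_distrib_left)
qed

lemma sum_set_subset: "sum_set a b j \<subseteq> {0..real j}"
proof
  fix t assume "t \<in> sum_set a b j"
  then obtain v where v: "\<forall>i<j. v i \<in> prod_set a b" "t = (\<Sum>i<j. v i)"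
    by (auto simp: sum_set_def)
  have "0 \<le> p \<and> p \<le> 1" if p: "p \<in> prod_set a b" for p
  proof -
    obtain x y where "p = x ^ a * y ^ b" "x \<in> C" "y \<in> C" using p by (auto simp: prod_set_def)
    moreover from this have "0 \<le> x" "x \<le> 1" "0 \<le> y" "y \<le> 1" using C_subset by auto
    ultimately show ?thesis by (simp add: mult_le_one power_le_one)
  qed
  then have "0 \<le> (\<Sum>i<j. v i)" "(\<Sum>i<j. v i) \<le> (\<Sum>i<j. 1)"
    using v by (intro sum_nonneg sum_mono; auto)+
  then show "t \<in> {0..real j}" using v by simp
qed

end

section \<open>Slopes of the monomial along the diagonal of a box\<close>

definition min_slope :: "nat \<Rightarrow> nat \<Rightarrow> real \<Rightarrow> real \<Rightarrow> real" where
  "min_slope a b q c = c ^ (a - 1) * (1 - q) ^ (b - 1) * (real b * c + real a * (1 - q))"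

text \<open>Like \<open>min_slope\<close>, a value of x^(a-1) y^(b-1) (b x + a y), the diagonal
  derivative divided by q: here at the upper right corner (c + q, 1), there at the lower left corner
  (c, 1 - q).\<close>

definition max_slope :: "nat \<Rightarrow> nat \<Rightarrow> real \<Rightarrow> real \<Rightarrow> real" where
  "max_slope a b q c = (c + q) ^ (a - 1) * (real b * (c + q) + real a)"

text \<open>Mean value theorem; the derivative increases along the diagonal, so its values at the
  two corners bound it.\<close>

lemma monomial_slope:
  fixes c q u v :: real
  assumes ab: "0 < a" "0 < b" and c: "0 \<le> c" and q: "0 < q" "q \<le> 1"
    and uv: "0 \<le> u" "u \<le> v" "v \<le> 1"
  defines "\<phi> \<equiv> \<lambda>e. (c + q * e) ^ a * (1 - q + q * e) ^ b"
  shows "q * min_slope a b q c * (v - u) \<le> \<phi> v - \<phi> u"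
    and "\<phi> v - \<phi> u \<le> q * max_slope a b q c * (v - u)"
proof -
  define g where "g e = (c + q * e) ^ (a - 1) * (1 - q + q * e) ^ (b - 1) *
    (real b * (c + q * e) + real a * (1 - q + q * e))" for e
  have g: "(\<phi> has_real_derivative q * g e) (at e)" for e
  proof -
    have pow: "((\<lambda>e. (p + q * e) ^ n) has_real_derivative real n * (p + q * e) ^ (n - 1) * q) (at e)"
      for p n by (auto intro!: derivative_eq_intros)
    obtain a' b' where "a = Suc a'" "b = Suc b'" using ab by (metis gr0_implies_Suc)
    then show ?thesis unfolding \<phi>_def g_def
      using DERIV_mult[OF pow[of c a] pow[of "1 - q" b]] by (simp add: algebra_simps)
  qed
  have bounds: "min_slope a b q c \<le> g e \<and> g e \<le> max_slope a b q c" if "0 \<le> e" "e \<le> 1" for e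
  proof -
    have e: "0 \<le> q * e" "q * e \<le> q" "0 \<le> e" using that q by (auto simp: mult_left_le)
    then have "g e \<le> (c + q) ^ (a - 1) * 1 * (real b * (c + q) + real a * 1)"
      using c q unfolding g_def
      by (intro mult_mono power_mono add_mono mult_left_mono power_le_one add_nonneg_nonneg mult_nonneg_nonneg zero_le_power) auto
    moreover have "min_slope a b q c \<le> g e"
      using c q e unfolding g_def min_slope_def
      by (intro mult_mono power_mono add_mono mult_left_mono add_nonneg_nonneg mult_nonneg_nonneg zero_le_power) auto
    ultimately show ?thesis by (simp add: max_slope_def)
  qed
  show "q * min_slope a b q c * (v - u) \<le> \<phi> v - \<phi> u" "\<phi> v - \<phi> u \<le> q * max_slope a b q c * (v - u)"
  proof -
    have "\<exists>e. u \<le> e \<and> e \<le> v \<and> \<phi> v - \<phi> u = (v - u) * (q * g e)"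
    proof (cases "u = v")
      case False
      then show ?thesis using MVT2[of u v \<phi> "\<lambda>e. q * g e"] uv g
        by (meson less_imp_le order_le_imp_less_or_eq)
    qed auto
    then obtain e where e: "u \<le> e" "e \<le> v" "\<phi> v - \<phi> u = (v - u) * (q * g e)" by blast
    then have "min_slope a b q c \<le> g e" "g e \<le> max_slope a b q c" using bounds uv by auto
    then have "(v - u) * (q * min_slope a b q c) \<le> (v - u) * (q * g e)"
      "(v - u) * (q * g e) \<le> (v - u) * (q * max_slope a b q c)"
      using uv q by (auto intro!: mult_left_mono)
    then show "q * min_slope a b q c * (v - u) \<le> \<phi> v - \<phi> u"
      "\<phi> v - \<phi> u \<le> q * max_slope a b q c * (v - u)"
      using e(3) by (auto simp: mult_ac)
  qed
qed

definition slope_ratio :: "nat \<Rightarrow> nat \<Rightarrow> real \<Rightarrow> real \<Rightarrow> real" where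
  "slope_ratio a b q c = max_slope a b q c / min_slope a b q c"

lemma min_slope_pos:
  assumes "0 < a" "0 < b" "0 < c" "q < 1" shows "0 < min_slope a b q c"
  using assms by (auto simp: min_slope_def intro!: mult_pos_pos add_pos_pos)

text \<open>Both (c + q) / c and (b (c + q) + a) / (b c + a (1 - q)) decrease in c. The product form
  is what the balance condition of a box at c consumes.\<close>

lemma slope_ratio_antimono:
  assumes ab: "0 < a" "0 < b" and "0 < w" "w \<le> c" and q: "0 < q" "q < 1"
  shows "max_slope a b q c \<le> slope_ratio a b q w * min_slope a b q c"
proof -
  have "(c + q) ^ (a - 1) * w ^ (a - 1) \<le> (w + q) ^ (a - 1) * c ^ (a - 1)"
    using assms by (simp flip: power_mult_distrib) (intro power_mono, auto simp: algebra_simps)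
  moreover have "(b * (c + q) + a) * (b * w + a * (1 - q)) \<le> (b * (w + q) + a) * (b * c + a * (1 - q))"
  proof -
    have "0 \<le> b * (c - w) * (b * q + a * q)" using assms by simp
    then show ?thesis by (simp add: algebra_simps)
  qed
  ultimately have "((c + q) ^ (a - 1) * w ^ (a - 1)) * ((b * (c + q) + a) * (b * w + a * (1 - q)))
     \<le> ((w + q) ^ (a - 1) * c ^ (a - 1)) * ((b * (w + q) + a) * (b * c + a * (1 - q)))"
    by (rule mult_mono) (use assms in auto)
  then have "(1 - q) ^ (b - 1) * (((c + q) ^ (a - 1) * w ^ (a - 1)) * ((b * (c + q) + a) * (b * w + a * (1 - q))))
     \<le> (1 - q) ^ (b - 1) * (((w + q) ^ (a - 1) * c ^ (a - 1)) * ((b * (w + q) + a) * (b * c + a * (1 - q))))"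
    using q by (intro mult_left_mono) auto
  then have "max_slope a b q c * min_slope a b q w \<le> max_slope a b q w * min_slope a b q c"
    by (simp add: max_slope_def min_slope_def mult_ac)
  then show ?thesis using min_slope_pos[OF ab \<open>0 < w\<close> q(2)]
    by (simp add: slope_ratio_def field_simps)
qed

text \<open>One factor 1 - q is absorbed by the linear factors, the others cancel those in
  \<open>min_slope\<close>. At w = 1 - r this leads to \<open>Q_ge\<close>.\<close>

lemma slope_ratio_ge:
  assumes ab: "0 < a" "0 < b" and w: "0 < w" and q: "0 < q" "q \<le> 1 - w"
  shows "1 \<le> slope_ratio a b q w * (1 - q) ^ b"
proof -
  have "b * w + a * (1 - q) \<le> (1 - q) * (b * (w + q) + a)"
  proof -
    have "0 \<le> b * q * (1 - q - w)" using q by simp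
    then show ?thesis by (simp add: algebra_simps)
  qed
  moreover have "w ^ (a - 1) \<le> (w + q) ^ (a - 1)" using w q by (intro power_mono) auto
  ultimately have "w ^ (a - 1) * (b * w + a * (1 - q)) \<le> (w + q) ^ (a - 1) * ((1 - q) * (b * (w + q) + a))"
    using w q by (intro mult_mono) auto
  then have "(1 - q) ^ (b - 1) * (w ^ (a - 1) * (b * w + a * (1 - q))) \<le> 
     (1 - q) ^ (b - 1) * ((w + q) ^ (a - 1) * ((1 - q) * (b * (w + q) + a)))"
    using w q by (intro mult_left_mono) auto
  moreover have "(1 - q) ^ b = (1 - q) * (1 - q) ^ (b - 1)" using ab by (auto simp: power_eq_if)
  ultimately have "min_slope a b q w \<le> max_slope a b q w * (1 - q) ^ b"
    by (simp add: max_slope_def min_slope_def mult_ac)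
  moreover have "0 < min_slope a b q w" using w q by (intro min_slope_pos ab) auto
  ultimately show ?thesis by (simp add: slope_ratio_def field_simps)
qed

section \<open>Covering intervals by equal boxes\<close>

locale cantor_products = self_similar_set +
  fixes a b n :: nat
  assumes a_pos: "0 < a" and a_le_b: "a \<le> b" and n_pos: "0 < n" and r_le_aq: "r \<le> a * r ^ n"
begin

abbreviation q :: real where "q \<equiv> r ^ n"

definition K :: real where "K = (1 - 2 * r) / r"

text \<open>The fraction in the first bound of the theorem; by \<open>slope_ratio_antimono\<close>
  it controls all boxes with c >= 1 - r at once.\<close>

definition Q :: real where "Q = slope_ratio a b q (1 - r)"

lemma b_pos: "0 < b"
  using a_pos a_le_b by simp

lemma q_pos: "0 < q"
  using r_pos by simp

lemma q_le_r: "q \<le> r"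
  using power_decreasing[of 1 n r] n_pos r_pos r_less_half by simp

lemma q_less_one: "q < 1"
  using q_le_r r_less_half by simp

lemma r_le_bq: "r \<le> b * q"
proof -
  have "a * q \<le> b * q" using a_le_b q_pos by (intro mult_right_mono) auto
  then show ?thesis using r_le_aq by linarith
qed

lemma K_pos: "0 < K"
  using r_pos r_less_half by (simp add: K_def)

lemma r_times_K: "r * K = 1 - 2 * r"
  using r_pos by (simp add: K_def)

text \<open>The choice of n_* enters through \<open>r_le_aq\<close>: q has not dropped below r / a,
  so a Bernoulli estimate bounds powers of 1 - q away from 1.\<close>

lemma one_minus_q_power_b: "(1 - q) ^ b * (1 + r) \<le> 1"
proof -
  have "(1 - q) ^ b * (1 + r) \<le> (1 - q) ^ b * (1 + b * q)"
    using r_le_bq q_less_one by (intro mult_left_mono) auto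
  also have "\<dots> \<le> 1" using one_minus_power_times_le_one[of q b] q_pos q_less_one by simp
  finally show ?thesis .
qed

lemma one_minus_q_power_sum: "(1 - q) ^ (a + b) * (1 + 2 * r) \<le> 1"
proof -
  have "2 * r \<le> real (a + b) * q" using r_le_aq r_le_bq by (simp add: algebra_simps)
  then have "(1 - q) ^ (a + b) * (1 + 2 * r) \<le> (1 - q) ^ (a + b) * (1 + real (a + b) * q)"
    using q_less_one by (intro mult_left_mono) auto
  also have "\<dots> \<le> 1" by (rule one_minus_power_times_le_one) (use q_pos q_less_one in auto)
  finally show ?thesis .
qed

lemma Q_ge: "1 + r \<le> Q"
proof -
  have "1 \<le> Q * (1 - q) ^ b"
    using slope_ratio_ge[of a b "1 - r" q] a_pos b_pos q_pos q_le_r r_less_half by (simp add: Q_def)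
  then have "1 * (1 + r) \<le> (Q * (1 - q) ^ b) * (1 + r)" using r_pos by (intro mult_right_mono) auto
  also have "\<dots> = Q * ((1 - q) ^ b * (1 + r))" by simp
  also have "\<dots> \<le> Q"
  proof -
    have "0 \<le> Q"
    proof (rule ccontr)
      assume "\<not> 0 \<le> Q"
      then have "Q * (1 - q) ^ b \<le> 0" using q_less_one by (intro mult_nonpos_nonneg) auto
      then show False using \<open>1 \<le> Q * (1 - q) ^ b\<close> by simp
    qed
    then show ?thesis using one_minus_q_power_b by (simp add: mult_left_le)
  qed
  finally show ?thesis by simp
qed

text \<open>On the diagonal of [c i, c i + q] x [1 - q, 1] a product depends on one point e of C,
  and both coordinates stay in C because c i and 1 - q are corners. The common factor q of all
  slopes cancels from the balance condition.\<close>

lemma sum_set_of_boxes: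
  assumes c: "\<And>i. i < N \<Longrightarrow> c i \<in> corners n"
    and balance: "\<And>i. i < N \<Longrightarrow> (1 - 2 * r) * max_slope a b q (c i) \<le>
      r * ((\<Sum>l<N. min_slope a b q (c l)) - min_slope a b q (c i))"
    and t: "(\<Sum>i<N. c i ^ a * (1 - q) ^ b) \<le> t" "t \<le> (\<Sum>i<N. (c i + q) ^ a)"
  shows "t \<in> sum_set a b N"
proof -
  define \<phi> where "\<phi> i e = (c i + q * e) ^ a * (1 - q + q * e) ^ b" for i e
  have "\<exists>e. (\<forall>i<N. e i \<in> C) \<and> (\<Sum>i<N. \<phi> i (e i)) = t"
  proof (rule sum_attained)
    fix i u v assume i: "i < N" and uv: "0 \<le> u" "u \<le> v" "v \<le> (1::real)"
    show "q * min_slope a b q (c i) * (v - u) \<le> \<phi> i v - \<phi> i u"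
      "\<phi> i v - \<phi> i u \<le> q * max_slope a b q (c i) * (v - u)"
      unfolding \<phi>_def
      using monomial_slope[OF a_pos b_pos cornersD(1)[OF c[OF i]] q_pos less_imp_le[OF q_less_one] uv]
      by auto
  next
    fix i assume "i < N"
    from balance[OF this]
    have "q * ((1 - 2 * r) * max_slope a b q (c i)) \<le>
        q * (r * ((\<Sum>l<N. min_slope a b q (c l)) - min_slope a b q (c i)))"
      using q_pos by simp
    then show "(1 - 2 * r) * (q * max_slope a b q (c i)) \<le>
        r * ((\<Sum>l<N. q * min_slope a b q (c l)) - q * min_slope a b q (c i))"
      by (simp add: sum_distrib_left[symmetric] algebra_simps)
  next
    show "continuous_on C (\<phi> i)" for i unfolding \<phi>_def by (intro continuous_intros)
  qed (use t in \<open>auto simp: \<phi>_def\<close>)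
  then obtain e where e: "\<And>i. i < N \<Longrightarrow> e i \<in> C" "(\<Sum>i<N. \<phi> i (e i)) = t" by blast
  have "\<phi> i (e i) \<in> prod_set a b" if "i < N" for i
    using cornersD(3)[OF c[OF that] e(1)[OF that]] cornersD(3)[OF last_corner e(1)[OF that]]
    unfolding \<phi>_def prod_set_def by blast
  then show ?thesis using sum_setI[of N "\<lambda>i. \<phi> i (e i)"] e(2) by auto
qed

text \<open>With D = c^a (1 - q)^b, j copies of the box cover [j D, j (c + q)^a] once j >= K Q + 1,
  and the ranges for j and j + 1 overlap. Starting at (K Q + 2) D leaves one unit for rounding j
  down.\<close>

lemma sum_set_replicated_box:
  assumes c: "c \<in> corners n" "1 - r \<le> c"
    and t: "(K * Q + 2) * (c ^ a * (1 - q) ^ b) \<le> t" "t \<le> m * (c + q) ^ a"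
    and m: "K * Q + 1 \<le> m"
  shows "t \<in> sum_set a b m"
proof -
  define D where "D = c ^ a * (1 - q) ^ b"
  have c_pos: "0 < c" "c + q \<le> 1" using c cornersD[OF c(1)] r_less_half by auto
  have D: "0 < D" using c_pos q_less_one by (simp add: D_def)
  have KQ: "K \<le> K * Q" using K_pos Q_ge r_pos by simp
  have "\<exists>j\<le>m. K * Q + 1 \<le> real j \<and> real j * D \<le> t \<and> t \<le> real j * (c + q) ^ a"
  proof (cases "m * D \<le> t")
    case True
    then show ?thesis using t m by blast
  next
    case False
    \<comment> \<open>The largest j with j D <= t; it remains to see that the range for j extends
      beyond (j + 1) D.\<close>
    define j where "j = nat \<lfloor>t / D\<rfloor>"
    have TD: "K * Q + 2 \<le> t / D" using t(1) D by (simp add: D_def[symmetric] field_simps)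
    then have "0 \<le> t / D" using K_pos KQ by linarith
    then have j: "real j \<le> t / D" "t / D < real j + 1" by (auto simp: j_def)
    have jK: "K * Q + 1 \<le> real j" using j TD by simp
    have "t / D < m" using False D by (simp add: field_simps)
    then have "real j < m" using j(1) by simp
    moreover have "t \<le> real j * (c + q) ^ a"
    proof -
      \<comment> \<open>The overlap follows from j + 1 <= j (1 + a q) (1 + b q), hence from 1 <= j
        (a q + b q); here j >= K + 1 and r (K + 1) = 1 - r >= 1 / 2.\<close>
      have "1 \<le> j * (2 * r)"
      proof -
        have "(K + 1) * (2 * r) \<le> j * (2 * r)" using jK KQ r_pos by (intro mult_right_mono) auto
        moreover have "(K + 1) * (2 * r) = 2 * (1 - r)" using r_times_K by (simp add: algebra_simps)
        ultimately show ?thesis using r_less_half by simp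
      qed
      also have "\<dots> \<le> j * (a * q + b * q)" using r_le_aq r_le_bq by (intro mult_left_mono) auto
      also have "\<dots> \<le> j * (a * q + b * q + (a * q) * (b * q))" using q_pos by (intro mult_left_mono) auto
      finally have "j + 1 \<le> j * ((1 + a * q) * (1 + b * q))" by (simp add: algebra_simps)
      then have "(j + 1) * (1 - q) ^ b \<le> j * ((1 + a * q) * (1 + b * q)) * (1 - q) ^ b"
        using q_less_one by (intro mult_right_mono) auto
      also have "\<dots> = j * (1 + a * q) * ((1 - q) ^ b * (1 + b * q))" by simp
      also have "\<dots> \<le> j * (1 + a * q)"
        using one_minus_power_times_le_one[of q b] q_pos q_less_one by (intro mult_left_le) auto
      finally have "c ^ a * ((j + 1) * (1 - q) ^ b) \<le> c ^ a * (j * (1 + a * q))"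
        using c_pos by (intro mult_left_mono) auto
      moreover have "c ^ a * (1 + a * q) \<le> (c + q) ^ a"
      proof -
        have "q * c \<le> q" using q_pos c_pos by (simp add: mult_left_le)
        then have "c * (1 + q) \<le> c + q" by (simp add: algebra_simps)
        have "c ^ a * (1 + a * q) \<le> c ^ a * (1 + q) ^ a"
          using Bernoulli_inequality[of q a] q_pos c_pos by (intro mult_left_mono) auto
        also have "\<dots> = (c * (1 + q)) ^ a" by (simp add: power_mult_distrib)
        also have "\<dots> \<le> (c + q) ^ a"
          using \<open>c * (1 + q) \<le> c + q\<close> c_pos q_pos by (intro power_mono) auto
        finally show ?thesis .
      qed
      then have "j * (c ^ a * (1 + a * q)) \<le> j * (c + q) ^ a" by (intro mult_left_mono) auto
      ultimately have "(j + 1) * D \<le> j * (c + q) ^ a" by (simp add: D_def mult_ac)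
      moreover have "t \<le> (j + 1) * D" using j(2) D by (simp add: field_simps)
      ultimately show ?thesis by simp
    qed
    moreover have "real j * D \<le> t" using j(1) D by (simp add: field_simps)
    ultimately show ?thesis using jK by (intro exI[of _ j]) auto
  qed
  then obtain j where j: "j \<le> m" "K * Q + 1 \<le> real j" "real j * D \<le> t" "t \<le> real j * (c + q) ^ a"
    by blast
  have "t \<in> sum_set a b j"
  proof (rule sum_set_of_boxes[where c = "\<lambda>_. c"])
    fix i assume "i < j"
    have "max_slope a b q c \<le> Q * min_slope a b q c"
      unfolding Q_def using c a_pos b_pos q_pos q_less_one r_less_half
      by (intro slope_ratio_antimono) auto
    then have "(1 - 2 * r) * max_slope a b q c \<le> (1 - 2 * r) * (Q * min_slope a b q c)"
      using r_less_half by (intro mult_left_mono) auto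
    also have "\<dots> = r * ((K * Q) * min_slope a b q c)" by (simp flip: r_times_K)
    also have "\<dots> \<le> r * ((real j - 1) * min_slope a b q c)"
      using j(2) r_pos min_slope_pos[OF a_pos b_pos c_pos(1) q_less_one]
      by (intro mult_left_mono mult_right_mono) auto
    finally show "(1 - 2 * r) * max_slope a b q c \<le>
        r * ((\<Sum>l<j. min_slope a b q c) - min_slope a b q c)"
      by (simp add: algebra_simps)
  qed (use c j in \<open>auto simp: D_def\<close>)
  then show ?thesis using sum_set_mono[OF a_pos j(1)] by blast
qed

lemma sum_set_last_box:
  assumes "(K * Q + 2) * (1 - q) ^ (a + b) \<le> t" "t \<le> real m" "K * Q + 1 \<le> m"
  shows "t \<in> sum_set a b m"
  using assms q_le_r
  by (intro sum_set_replicated_box[OF last_corner]) (auto simp: power_add)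

text \<open>Moving the corner c through [1 - r, 1 - q] joins the ranges of
  \<open>sum_set_replicated_box\<close>. The second bound on m makes each range long enough to cross
  the gap to the next corner.\<close>

lemma sum_set_box_chain:
  assumes t: "(K * Q + 2) * (1 - q) ^ b * (1 - r) ^ a \<le> t" "t \<le> real m"
    and m: "K * Q + 1 \<le> m"
      "(K * Q + 2) * (1 - q) ^ b * (1 + r * (1 - 2 * r) / (1 - r)) ^ a \<le> m"
  shows "t \<in> sum_set a b m"
proof -
  define P where "P = (K * Q + 2) * (1 - q) ^ b"
  have "0 < K * Q" using K_pos Q_ge r_pos by simp
  then have P: "0 < P" using q_less_one by (simp add: P_def)
  have "0 < P * (1 - r) ^ a" using P r_less_half by simp
  then have "0 < t" using t(1) by (simp add: P_def)
  \<comment> \<open>The ideal corner, P \<tau>^a = t: a box at any corner c <= \<tau> starts low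
    enough for t.\<close>
  define \<tau> where "\<tau> = root a (t / P)"
  have \<tau>: "\<tau> ^ a = t / P" "0 \<le> \<tau>" using a_pos \<open>0 < t\<close> P by (auto simp: \<tau>_def)
  have "(1 - r) ^ a \<le> \<tau> ^ a" using t(1) P unfolding P_def[symmetric] \<tau>(1) by (simp add: field_simps)
  then have \<tau>_ge: "1 - r \<le> \<tau>" using \<tau>(2) a_pos power_mono_iff[of "1 - r" \<tau> a] r_less_half by auto
  show ?thesis
  proof (cases "1 \<le> \<tau>")
    case True
    then have "P \<le> t" using one_le_power[of \<tau> a] \<tau>(1) P by (simp add: field_simps)
    moreover have "P * (1 - q) ^ a \<le> P" using P q_pos q_less_one by (intro mult_left_le power_le_one) auto
    ultimately show ?thesis
      using t(2) m(1) by (intro sum_set_last_box) (auto simp: P_def power_add mult_ac)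
  next
    case False
    \<comment> \<open>The corner is sought inside the right branch, at level n - 1 after rescaling,
      so the widest gap is r (1 - 2 r) instead of 1 - 2 r.\<close>
    obtain n' where n': "n = Suc n'" using n_pos by (cases n) auto
    define z where "z = (\<tau> - (1 - r)) / r"
    have "0 \<le> z" "z \<le> 1" using False \<tau>_ge r_pos by (auto simp: z_def)
    then obtain d where d: "d \<in> corners n'" "d \<le> z" "z \<le> d + r ^ n' + (1 - 2 * r)"
      using ex_corner_near[of z n'] by blast
    define c where "c = 1 - r + r * d"
    have c: "c \<in> corners n" using corners_scale_right[OF d(1)] by (simp add: c_def n')
    have c_ge: "1 - r \<le> c" using cornersD(1)[OF d(1)] r_pos by (simp add: c_def)
    have \<tau>_eq: "\<tau> = 1 - r + r * z" using r_pos by (simp add: z_def)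
    have "c \<le> \<tau>" using d(2) r_pos by (simp add: c_def \<tau>_eq)
    have "r * z \<le> r * (d + r ^ n' + (1 - 2 * r))" using d(3) r_pos by simp
    then have "\<tau> \<le> c + q + r * (1 - 2 * r)" by (simp add: c_def \<tau>_eq n' algebra_simps)
    \<comment> \<open>The gap is made relative to c + q, which is at least 1 - r, so that it can be
      taken to the power a.\<close>
    also have "\<dots> \<le> (c + q) * (1 + r * (1 - 2 * r) / (1 - r))"
    proof -
      have "1 - r \<le> c + q" using c_ge q_pos by linarith
      then have "r * (1 - 2 * r) * (1 - r) \<le> r * (1 - 2 * r) * (c + q)"
        using r_pos r_less_half by (intro mult_left_mono) auto
      then show ?thesis using r_less_half by (simp add: field_simps)
    qed
    finally have "\<tau> ^ a \<le> ((c + q) * (1 + r * (1 - 2 * r) / (1 - r))) ^ a"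
      using \<tau>(2) by (intro power_mono) auto
    then have "P * \<tau> ^ a \<le> P * ((c + q) * (1 + r * (1 - 2 * r) / (1 - r))) ^ a"
      using P by simp
    also have "\<dots> = (P * (1 + r * (1 - 2 * r) / (1 - r)) ^ a) * (c + q) ^ a"
      by (simp add: power_mult_distrib)
    also have "\<dots> \<le> m * (c + q) ^ a"
      using m(2) c_ge q_pos r_less_half by (intro mult_right_mono) (auto simp: P_def)
    finally have "t \<le> m * (c + q) ^ a" using \<tau>(1) P by simp
    moreover have "P * c ^ a \<le> P * \<tau> ^ a"
      using \<open>c \<le> \<tau>\<close> c_ge r_less_half P by (intro mult_left_mono power_mono) auto
    then have "P * c ^ a \<le> t" using \<tau>(1) P by simp
    ultimately show ?thesis
      using c c_ge m(1) by (intro sum_set_replicated_box[of c]) (auto simp: P_def mult_ac)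
  qed
qed

end

section \<open>Reaching down to r^a m: large r, small r, and a = 1\<close>

lemma sum_if_less:
  fixes x y :: real and j m :: nat
  assumes "j \<le> m"
  shows "(\<Sum>i<m. if i < j then x else y) = j * x + (real m - j) * y"
proof -
  have "(\<Sum>i<m. if i < j then x else y) = (\<Sum>i\<in>{..<m} \<inter> {i. i < j}. x) + (\<Sum>i\<in>{..<m} \<inter> - {i. i < j}. y)"
    by (rule sum.If_cases) simp
  also have "{..<m} \<inter> {i. i < j} = {..<j}" using assms by auto
  also have "{..<m} \<inter> - {i. i < j} = {j..<m}" by auto
  finally show ?thesis using assms by (simp add: of_nat_diff)
qed

context cantor_products
begin

lemma ratio_eq: "(1 - r) / r = 1 + K"
  using r_pos by (simp add: K_def field_simps)

lemma r_times_one_plus_K: "r * (1 + K) = 1 - r"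
  using r_times_K by (simp add: algebra_simps)

lemma KQ_nonneg: "0 \<le> K * Q"
  using K_pos Q_ge r_pos by simp

text \<open>Here (K Q + 2) (1 - q)^b <= Q + 1, so by the bound on m the box chain starts at or below
  r^a m.\<close>

lemma top_interval_of_large_ratio:
  assumes r: "9 / 25 \<le> r" and m: "((1 - r) / r) ^ a * (Q + 1) \<le> m"
  shows "{r ^ a * real m..m} \<subseteq> sum_set a b m"
proof
  fix t assume t: "t \<in> {r ^ a * real m..m}"
  have sq: "r * r \<ge> (9 / 25) * (9 / 25)" using r by (intro mult_mono) auto
  then have cube: "r * r * r \<ge> ((9 / 25) * (9 / 25)) * (9 / 25)" using r by (intro mult_mono) auto
  \<comment> \<open>Equivalent to r - r^2 <= (r^2 + 3 r - 1) Q. With Q >= 1 + r it suffices that r^3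
    + 5 r^2 + r >= 1, which holds from 9/25 on.\<close>
  have "r * (K * Q + 2) \<le> r * ((1 + r) * (Q + 1))"
  proof -
    have "(r * r + 3 * r - 1) * (1 + r) \<le> (r * r + 3 * r - 1) * Q"
      using sq r Q_ge by (intro mult_left_mono) auto
    moreover have "r - r * r \<le> (r * r + 3 * r - 1) * (1 + r)"
      using sq cube r by (simp add: algebra_simps)
    moreover have "r * (K * Q + 2) = (1 - 2 * r) * Q + 2 * r"
      by (simp add: distrib_left flip: r_times_K)
    ultimately show ?thesis by (simp add: algebra_simps)
  qed
  then have "K * Q + 2 \<le> (1 + r) * (Q + 1)" using r_pos by simp
  then have "(K * Q + 2) * (1 - q) ^ b \<le> (1 + r) * (Q + 1) * (1 - q) ^ b"
    using q_less_one by (intro mult_right_mono) auto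
  also have "\<dots> = (Q + 1) * ((1 - q) ^ b * (1 + r))" by simp
  also have "\<dots> \<le> Q + 1" using one_minus_q_power_b Q_ge r_pos by (intro mult_left_le) auto
  finally have P: "(K * Q + 2) * (1 - q) ^ b \<le> Q + 1" .
  have "1 ^ a \<le> (1 + K) ^ a" using K_pos by (intro power_mono) auto
  then have A: "1 \<le> (1 + K) ^ a" by simp
  have m': "(1 + K) ^ a * (Q + 1) \<le> m" using m by (simp add: ratio_eq)
  have "K \<le> 1"
  proof -
    have "r * K \<le> r * 1" using r_times_K r by simp
    then show ?thesis using r_pos by simp
  qed
  show "t \<in> sum_set a b m"
  proof (rule sum_set_box_chain)
    have "(K * Q + 2) * (1 - q) ^ b * (1 - r) ^ a \<le> (Q + 1) * (1 - r) ^ a"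
      using P r_less_half by (intro mult_right_mono) auto
    also have "\<dots> = r ^ a * ((1 + K) ^ a * (Q + 1))"
      by (simp flip: r_times_one_plus_K add: power_mult_distrib)
    also have "\<dots> \<le> r ^ a * m" using m' r_pos by (intro mult_left_mono) auto
    finally show "(K * Q + 2) * (1 - q) ^ b * (1 - r) ^ a \<le> t" using t by simp
    have "K * Q \<le> Q" using \<open>K \<le> 1\<close> Q_ge r_pos K_pos by (intro mult_left_le_one_le) auto
    moreover have "1 * (Q + 1) \<le> (1 + K) ^ a * (Q + 1)" using A Q_ge r_pos by (intro mult_right_mono) auto
    ultimately show "K * Q + 1 \<le> m" using m' by simp
    have "r * (1 - 2 * r) / (1 - r) \<le> K"
    proof -
      have "r * r \<le> 1 * (1 / 2)" using r_pos r_less_half by (intro mult_mono) auto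
      then have "(1 - 2 * r) * (r * r) \<le> (1 - 2 * r) * (1 - r)"
        using r_less_half by (intro mult_left_mono) auto
      then show ?thesis using r_pos r_less_half by (simp add: K_def field_simps)
    qed
    then have "(1 + r * (1 - 2 * r) / (1 - r)) ^ a \<le> (1 + K) ^ a"
      using r_pos r_less_half by (intro power_mono) auto
    then have "(K * Q + 2) * (1 - q) ^ b * (1 + r * (1 - 2 * r) / (1 - r)) ^ a \<le> (Q + 1) * (1 + K) ^ a"
      using P Q_ge r_pos r_less_half by (intro mult_mono) auto
    then show "(K * Q + 2) * (1 - q) ^ b * (1 + r * (1 - 2 * r) / (1 - r)) ^ a \<le> m"
      using m' by (simp add: mult.commute)
  qed (use t in auto)
qed

text \<open>Frozen pairs at (1 - r, 1) contribute X = (1 - r)^a each; the others, scaled by r^a,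
  range over what \<open>sum_set_last_box\<close> covers. The first bound on m keeps the scaled
  remainder above the lower end of that range.\<close>

lemma sum_set_mixed_scales:
  assumes t: "r ^ a * real m \<le> t" "t \<le> (K * Q + 2) * (1 - q) ^ b * (1 - r) ^ a"
    and m1: "((1 - r) / r) ^ a + (K * Q + 2) * ((1 - q) ^ b + (1 - q) ^ (a + b)) \<le> m"
    and m2: "(K * Q + 2) * (1 - q) ^ b + K * Q + 2 \<le> m"
  shows "t \<in> sum_set a b m"
proof -
  define P where "P = (K * Q + 2) * (1 - q) ^ b"
  define X where "X = (1 - r) ^ a"
  define R where "R = r ^ a"
  have R: "0 < R" using r_pos by (simp add: R_def)
  have XR: "R < X" unfolding R_def X_def
    using r_pos r_less_half a_pos by (intro power_strict_mono) auto
  \<comment> \<open>The fractional number of frozen pairs for which t is hit with all other pairs at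
    (r, 1), the top of their scaled range.\<close>
  define s where "s = (t - R * m) / (X - R)"
  have s: "0 \<le> s" "t = R * m + s * (X - R)" using t(1) XR by (auto simp: s_def R_def)
  have Pm: "P \<le> m" using m2 KQ_nonneg by (simp add: P_def)
  have "s * (X - R) \<le> P * (X - R)"
  proof -
    have "R * P \<le> R * m" using Pm R by simp
    then show ?thesis using t(2) s(2) by (simp add: P_def X_def algebra_simps)
  qed
  then have sP: "s \<le> P" using XR by simp
  \<comment> \<open>Rounding up keeps the remainder below (m - p) R and lowers it by at most X = ((1
    - r) / r)^a R.\<close>
  define p where "p = nat \<lceil>s\<rceil>"
  have p: "s \<le> p" "p < s + 1" using s(1) unfolding p_def by linarith+
  have pm: "p \<le> m" "K * Q + 1 \<le> real (m - p)"
  proof -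
    have "real p \<le> m - (K * Q + 1)" using p(2) sP m2 by (simp add: P_def)
    then show "p \<le> m" using KQ_nonneg by simp
    then show "K * Q + 1 \<le> real (m - p)" using \<open>real p \<le> m - (K * Q + 1)\<close> by (simp add: of_nat_diff)
  qed
  define u where "u = (t - p * X) / R"
  have tu: "t = p * X + R * u" using R by (simp add: u_def)
  have "u \<in> sum_set a b (m - p)"
  proof (rule sum_set_last_box)
    have "t - p * X \<le> R * m - p * R"
      using mult_right_mono[OF p(1), of "X - R"] XR s(2) by (simp add: algebra_simps)
    then show "u \<le> real (m - p)" using R pm(1) by (simp add: u_def field_simps of_nat_diff)
    have "X = ((1 - r) / r) ^ a * R" using r_pos by (simp add: X_def R_def power_divide)
    moreover have "(p - s) * X \<le> 1 * X"
      using p(2) XR R by (intro mult_right_mono) auto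
    ultimately have "R * (m - s - ((1 - r) / r) ^ a) \<le> t - p * X"
      using s(2) by (simp add: algebra_simps)
    then have "m - s - ((1 - r) / r) ^ a \<le> u" using R by (simp add: u_def field_simps)
    then show "(K * Q + 2) * (1 - q) ^ (a + b) \<le> u"
      using m1 sP by (simp add: P_def algebra_simps)
  qed (use pm in auto)
  then have "R * u \<in> sum_set a b (m - p)" by (simp add: R_def sum_set_scale)
  moreover have "1 - r \<in> C" using right_branch[OF zero_in_C] by simp
  then have "X \<in> prod_set a b"
    using one_in_C unfolding prod_set_def X_def
    by (intro CollectI exI[of _ "1 - r"] exI[of _ 1]) auto
  then have "p * X \<in> sum_set a b p" by (rule sum_set_replicate)
  ultimately have "p * X + R * u \<in> sum_set a b (p + (m - p))" by (intro sum_set_add)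
  then show ?thesis using tu pm(1) by simp
qed

text \<open>The box chain covers the upper part and mixed scales the rest. Since a >= 2, the
  estimates reduce to ones with (1 + K)^2.\<close>

lemma top_interval_of_small_ratio:
  assumes a: "2 \<le> a" and r: "r \<le> 9 / 25" and m: "((1 - r) / r) ^ a * (Q + 1) \<le> m"
  shows "{r ^ a * real m..m} \<subseteq> sum_set a b m"
proof
  fix t assume t: "t \<in> {r ^ a * real m..m}"
  define N where "N = K * Q + 2"
  have N: "0 < N" using KQ_nonneg by (simp add: N_def)
  have Q1: "1 \<le> Q" using Q_ge r_pos by simp
  \<comment> \<open>7/9 is the value of K at r = 9/25.\<close>
  have K7: "7 / 9 \<le> K"
  proof -
    have "r * (7 / 9) \<le> r * K" using r_times_K r by simp
    then show ?thesis using r_pos by simp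
  qed
  then have KK: "(7 / 9) * (7 / 9) \<le> K * K" by (intro mult_mono) auto
  obtain d where d: "a = d + 2" using a by (metis add.commute le_Suc_ex)
  have A: "(1 + K) ^ 2 \<le> (1 + K) ^ a" using a K_pos by (intro power_increasing) auto
  have m': "(1 + K) ^ a * (Q + 1) \<le> m" using m by (simp add: ratio_eq)
  have "(1 + K) ^ 2 * (Q + 1) \<le> (1 + K) ^ a * (Q + 1)"
    using A Q1 by (intro mult_right_mono) auto
  then have m_ge: "(1 + K) ^ 2 * (Q + 1) \<le> m" using m' by simp
  have "K * K * 1 \<le> K * K * Q" using Q1 K_pos by (intro mult_left_mono) auto
  then have KKQ: "(7 / 9) * (7 / 9) \<le> K * K * Q" using KK by linarith
  have N2: "2 * N \<le> (1 + K) ^ 2 * (Q + 1)"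
    using KK KKQ K7 Q1 by (simp add: N_def power2_eq_square algebra_simps)
  have PN: "N * (1 - q) ^ b \<le> N"
    using N q_pos q_less_one by (intro mult_left_le power_le_one) auto
  define \<kappa> where "\<kappa> = 1 + r * (1 - 2 * r) / (1 - r)"
  have \<kappa>: "1 \<le> \<kappa>" using r_pos r_less_half by (simp add: \<kappa>_def)
  \<comment> \<open>After clearing denominators, completing the square gives the centre 59/200. The
    bound ensures \<kappa>^2 <= 2 and \<kappa> <= 1 + K.\<close>
  have \<kappa>2: "\<kappa> \<le> 59 / 50"
  proof -
    have "0 \<le> (r - 59 / 200) * (r - 59 / 200)" by simp
    then show ?thesis using r_less_half by (simp add: \<kappa>_def field_simps)
  qed
  then have "\<kappa> * \<kappa> \<le> (59 / 50) * (59 / 50)" using \<kappa> by (intro mult_mono) auto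
  then have "N * (\<kappa> * \<kappa>) \<le> N * 2" using N by (intro mult_left_mono) auto
  then have chi2: "N * \<kappa> ^ 2 \<le> (1 + K) ^ 2 * (Q + 1)" using N2 by (simp add: power2_eq_square)
  moreover have "\<kappa> ^ d \<le> (1 + K) ^ d" using \<kappa> \<kappa>2 K7 by (intro power_mono) auto
  ultimately have "(N * \<kappa> ^ 2) * \<kappa> ^ d \<le> ((1 + K) ^ 2 * (Q + 1)) * (1 + K) ^ d"
    by (rule mult_mono) (use \<kappa> Q1 K_pos in auto)
  moreover have "x ^ a = x ^ 2 * x ^ d" for x :: real by (simp add: d power2_eq_square)
  ultimately have "N * \<kappa> ^ a \<le> m" using m' by (simp add: mult_ac)
  moreover have "N * (1 - q) ^ b * \<kappa> ^ a \<le> N * \<kappa> ^ a"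
    using PN \<kappa> by (intro mult_right_mono) auto
  ultimately have chain: "N * (1 - q) ^ b * \<kappa> ^ a \<le> m" by simp
  have m2: "N * (1 - q) ^ b + N \<le> m" using PN N2 m_ge by simp
  show "t \<in> sum_set a b m"
  proof (cases "N * (1 - q) ^ b * (1 - r) ^ a \<le> t")
    case True
    have "0 \<le> N * (1 - q) ^ b" using N q_less_one by simp
    then show ?thesis
      using True t m2 chain by (intro sum_set_box_chain) (auto simp: N_def \<kappa>_def)
  next
    case False
    have "N * (2 + 3 * r) \<le> (1 + K) ^ 2 * Q * ((1 + r) * (1 + 2 * r))"
    proof -
      \<comment> \<open>After multiplication by r^2 the claim reads 4 r^2 + 6 r^3 <= p Q, with p the
        collected coefficient of Q; as p >= 0, Q may be replaced by 1 + r.\<close>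
      define p where "p = 1 - r - 2 * r ^ 2 + 5 * r ^ 3 + 2 * r ^ 4"
      have r2: "r ^ 2 \<le> 81 / 625" using r r_pos power_mono[of r "9 / 25" 2] by (simp add: power2_eq_square)
      have r3: "r ^ 3 \<le> 9 / 25 * r ^ 2"
        using mult_right_mono[OF r, of "r ^ 2"] by (simp add: power3_eq_cube power2_eq_square)
      \<comment> \<open>Tangent to the square of r^2 at 81/625 = (9/25)^2, which makes the remaining
        inequality linear in the powers of r.\<close>
      have r4: "r ^ 4 \<ge> 162 / 625 * r ^ 2 - (81 / 625) ^ 2"
      proof -
        have "0 \<le> (r ^ 2 - 81 / 625) ^ 2" by simp
        then show ?thesis by (simp add: power2_diff algebra_simps flip: power_mult)
      qed
      have pos: "0 \<le> r ^ 3" "0 \<le> r ^ 4" "0 \<le> r ^ 5" using r_pos by auto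
      have p0: "0 \<le> p" using r r2 pos by (simp add: p_def)
      have "4 * r ^ 2 + 6 * r ^ 3 \<le> 1 - 3 * r ^ 2 + 3 * r ^ 3 + 7 * r ^ 4 + 2 * r ^ 5"
        using r2 r3 r4[unfolded power2_eq_square[of "81 / 625"]] pos by linarith
      also have "\<dots> = p * (1 + r)"
        by (simp add: p_def algebra_simps eval_nat_numeral)
      also have "\<dots> \<le> p * Q" using p0 Q_ge by (intro mult_left_mono) auto
      finally have poly: "4 * r ^ 2 + 6 * r ^ 3 \<le> p * Q" .
      have rN: "r * N = (1 - 2 * r) * Q + 2 * r"
        by (simp add: N_def distrib_left flip: r_times_K)
      have "r ^ 2 * (N * (2 + 3 * r)) = r * (r * N) * (2 + 3 * r)" by (simp add: power2_eq_square)
      also have "\<dots> \<le> (1 - r) ^ 2 * Q * ((1 + r) * (1 + 2 * r))"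
        unfolding rN using poly by (simp add: p_def algebra_simps eval_nat_numeral)
      also have "\<dots> = r ^ 2 * ((1 + K) ^ 2 * Q * ((1 + r) * (1 + 2 * r)))"
        by (simp flip: r_times_one_plus_K add: power_mult_distrib)
      finally show ?thesis using r_pos by simp
    qed
    moreover have "N * ((1 - q) ^ b + (1 - q) ^ (a + b)) * ((1 + r) * (1 + 2 * r)) \<le> N * (2 + 3 * r)"
    proof -
      have "(1 - q) ^ b * (1 + r) * (1 + 2 * r) \<le> 1 * (1 + 2 * r)"
        using one_minus_q_power_b r_pos by (intro mult_right_mono) auto
      moreover have "(1 - q) ^ (a + b) * (1 + 2 * r) * (1 + r) \<le> 1 * (1 + r)"
        using one_minus_q_power_sum r_pos by (intro mult_right_mono) auto
      ultimately have "((1 - q) ^ b + (1 - q) ^ (a + b)) * ((1 + r) * (1 + 2 * r)) \<le> 2 + 3 * r"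
        by (simp add: algebra_simps)
      then have "N * (((1 - q) ^ b + (1 - q) ^ (a + b)) * ((1 + r) * (1 + 2 * r))) \<le> N * (2 + 3 * r)"
        using N by (intro mult_left_mono) auto
      then show ?thesis by (simp add: mult.assoc)
    qed
    ultimately have "N * ((1 - q) ^ b + (1 - q) ^ (a + b)) * ((1 + r) * (1 + 2 * r)) \<le>
        (1 + K) ^ 2 * Q * ((1 + r) * (1 + 2 * r))" by linarith
    moreover have "0 < (1 + r) * (1 + 2 * r)" using r_pos by simp
    ultimately have "N * ((1 - q) ^ b + (1 - q) ^ (a + b)) \<le> (1 + K) ^ 2 * Q"
      using mult_le_cancel_right_pos by blast
    moreover have "(1 + K) ^ 2 * Q \<le> (1 + K) ^ a * Q" using A Q1 by (intro mult_right_mono) auto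
    ultimately have "(1 + K) ^ a + N * ((1 - q) ^ b + (1 - q) ^ (a + b)) \<le> m"
      using m' by (simp add: algebra_simps)
    then show ?thesis using False t m2
      by (intro sum_set_mixed_scales) (auto simp: N_def ratio_eq)
  qed
qed

text \<open>For a = 1 a box at c = 0 still has the positive minimal slope L, so j boxes sit at 1 - r
  and the other m - j at 0, all contributing to the balance.\<close>

lemma top_interval_of_linear:
  assumes a: "a = 1" and n: "n = 1"
    and m: "(1 - r) / r * (Q + 1) \<le> m" "((1 - r) / r) ^ 2 \<le> m"
  shows "{r ^ a * real m..m} \<subseteq> sum_set a b m"
proof
  fix t assume t: "t \<in> {r ^ a * real m..m}"
  define L where "L = (1 - r) ^ b"
  have L: "0 < L" "L \<le> 1" using r_pos r_less_half by (auto simp: L_def intro!: power_le_one)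
  have pow_b: "(1 - r) ^ b = (1 - r) * (1 - r) ^ (b - 1)" using b_pos by (auto simp: power_eq_if)
  have min: "min_slope a b q (1 - r) = (b + 1) * L" "min_slope a b q 0 = L"
    by (auto simp: min_slope_def a n L_def pow_b algebra_simps)
  have max: "max_slope a b q (1 - r) = b + 1" "max_slope a b q 0 = b * r + 1"
    by (auto simp: max_slope_def a n)
  have QL: "Q * L = 1" using L(1) by (simp add: Q_def slope_ratio_def min max)
  have Q_ge': "1 + b * r \<le> Q"
  proof -
    have "L * (1 + b * r) \<le> L * Q"
      using one_minus_power_times_le_one[of r b] r_pos r_less_half QL by (simp add: L_def mult.commute)
    then show ?thesis using L by simp
  qed
  have m1: "(1 + K) * (Q + 1) \<le> m" and m2: "(1 + K) * (1 + K) \<le> m"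
    using m by (auto simp: ratio_eq power2_eq_square)
  have rm: "(1 - r) * (1 + K) \<le> r * m"
  proof -
    have "r * ((1 + K) * (1 + K)) \<le> r * m" using m2 r_pos by (intro mult_left_mono) auto
    then show ?thesis by (simp flip: r_times_one_plus_K add: mult.assoc)
  qed
  \<comment> \<open>The three conditions on j are the balance of slopes divided by r L, and the
    lower and upper ends of the sums over the boxes.\<close>
  have "\<exists>j\<le>m. (K * Q + 1) * (b + 1) \<le> b * real j + m \<and> j * ((1 - r) * L) \<le> t \<and>
      t \<le> j + (real m - j) * r"
  proof (cases "m * ((1 - r) * L) \<le> t")
    case True
    have "K * Q + 1 \<le> m" using m1 K_pos Q_ge r_pos by (simp add: algebra_simps)
    then have "(K * Q + 1) * (b + 1) \<le> real m * real (b + 1)" by (intro mult_right_mono) auto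
    then show ?thesis using True t by (intro exI[of _ m]) (auto simp: algebra_simps)
  next
    case False
    define D where "D = (1 - r) * L"
    have D: "0 < D" using L r_less_half by (simp add: D_def)
    define j where "j = nat \<lfloor>t / D\<rfloor>"
    have "(1 + K) * Q * D = (1 - r) * (1 + K) * (Q * L)" by (simp add: D_def)
    also have "\<dots> = (1 - r) * (1 + K)" using QL by simp
    also have "\<dots> \<le> t" using rm t by (simp add: a)
    finally have TD: "(1 + K) * Q \<le> t / D" using D by (simp add: field_simps)
    moreover have "0 \<le> (1 + K) * Q" using K_pos Q_ge r_pos by simp
    ultimately have "0 \<le> t / D" by simp
    then have j: "real j \<le> t / D" "t / D < real j + 1" by (auto simp: j_def)
    have "t / D < m" using False D by (simp add: D_def field_simps)
    then have "j \<le> m" using j(1) by simp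
    moreover have "(K * Q + 1) * (b + 1) \<le> b * real j + m"
    proof -
      \<comment> \<open>What the balance becomes after inserting j > (1 + K) Q - 1 and m >= (1 + K)
        (Q + 1). With Q >= 1 + u it reduces to u <= 1 - r + u^2 + u r, where u = b r.\<close>
      have "2 * b \<le> b * Q + K + Q"
      proof -
        define u where "u = b * r"
        have u: "0 \<le> u" by (simp add: u_def r_pos less_imp_le)
        have "u \<le> 1 - r + u * u + u * r"
        proof (cases "u \<le> 1")
          case True
          then have "0 \<le> (1 - u) * (1 - r)" using r_less_half by simp
          then show ?thesis using u by (simp add: algebra_simps) (smt (verit) mult_nonneg_nonneg)
        next
          case False
          then have "u * 1 \<le> u * u" by (intro mult_left_mono) auto
          moreover have "0 \<le> u * r" using u r_pos by simp
          ultimately show ?thesis using r_less_half by simp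
        qed
        moreover have "r * (1 + K + b * u + u) = 1 - r + u * u + u * r"
          using r_times_one_plus_K by (simp add: u_def algebra_simps)
        ultimately have "r * b \<le> r * (1 + K + b * u + u)" by (simp add: u_def mult.commute)
        then have "b \<le> 1 + K + b * u + u" using r_pos by simp
        moreover have "b * (1 + u) \<le> b * Q" "1 + u \<le> Q"
          using Q_ge' by (auto simp: u_def intro!: mult_left_mono)
        ultimately show ?thesis by (simp add: algebra_simps)
      qed
      moreover have "b * ((1 + K) * Q - 1) \<le> b * real j" using TD j(2) by (intro mult_left_mono) auto
      ultimately show ?thesis using m1 by (simp add: algebra_simps)
    qed
    moreover have "t \<le> j + (real m - j) * r"
    proof -
      have "t \<le> (j + 1) * D" using j(2) D by (simp add: field_simps)
      also have "\<dots> \<le> (j + 1) * ((1 - r) * 1)"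
        unfolding D_def using L r_less_half by (intro mult_left_mono) auto
      also have "\<dots> \<le> j * (1 - r) + r * m"
      proof -
        have "(1 - r) * 1 \<le> (1 - r) * (1 + K)" using K_pos r_less_half by (intro mult_left_mono) auto
        then show ?thesis using rm by (simp add: algebra_simps)
      qed
      finally show ?thesis by (simp add: algebra_simps)
    qed
    moreover have "j * D \<le> t" using j(1) D by (simp add: field_simps)
    ultimately show ?thesis unfolding D_def by blast
  qed
  then obtain j where j: "j \<le> m" "(K * Q + 1) * (b + 1) \<le> b * real j + m"
      "j * ((1 - r) * L) \<le> t" "t \<le> j + (real m - j) * r" by blast
  have bal: "(1 - 2 * r) * (b + 1) \<le> r * (j * ((b + 1) * L) + (real m - j) * L - (b + 1) * L)"
  proof -
    have "(1 - 2 * r) * (b + 1) = (r * K) * (Q * L) * (b + 1)" by (simp only: r_times_K QL mult_1_right)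
    also have "\<dots> = (r * L) * (K * Q * (b + 1))" by simp
    also have "\<dots> \<le> (r * L) * (b * real j + m - (b + 1))"
      using j(2) r_pos L by (intro mult_left_mono) (auto simp: algebra_simps)
    finally show ?thesis by (simp add: algebra_simps)
  qed
  define c where "c i = (if i < j then 1 - r else 0)" for i
  have sum_min: "(\<Sum>l<m. min_slope a b q (c l)) = j * ((b + 1) * L) + (real m - j) * L"
    unfolding sum_if_less[OF j(1), symmetric] by (intro sum.cong) (auto simp: c_def min)
  show "t \<in> sum_set a b m"
  proof (rule sum_set_of_boxes[where c = c])
    fix i assume "i < m"
    have "0 \<in> corners 1" using corners_refine_left[OF zero_in_corners_0] by simp
    then show "c i \<in> corners n" using last_corner[of 1] by (simp add: c_def n)
    show "(1 - 2 * r) * max_slope a b q (c i) \<le>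
      r * ((\<Sum>l<m. min_slope a b q (c l)) - min_slope a b q (c i))"
    proof (cases "i < j")
      case True
      then show ?thesis using bal by (simp add: sum_min) (simp add: c_def max min)
    next
      case False
      \<comment> \<open>A box at 0 has a smaller maximal slope and takes less from the sum of
        minimal slopes, so the balance for c = 1 - r implies its own.\<close>
      have "(1 - 2 * r) * (b * r + 1) \<le> (1 - 2 * r) * (b + 1)"
        using r_less_half by (intro mult_left_mono) (auto simp: mult_left_le)
      also note bal
      also have "r * (j * ((b + 1) * L) + (real m - j) * L - (b + 1) * L) \<le>
          r * (j * ((b + 1) * L) + (real m - j) * L - L)"
        using r_pos L by (intro mult_left_mono) (auto simp: algebra_simps)
      finally show ?thesis using False by (simp add: sum_min) (simp add: c_def max min)
    qed
  next
    have "(\<Sum>i<m. c i ^ a * (1 - q) ^ b) = (\<Sum>i<m. if i < j then (1 - r) * L else 0)"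
      by (intro sum.cong) (auto simp: c_def a n L_def)
    then show "(\<Sum>i<m. c i ^ a * (1 - q) ^ b) \<le> t" using j by (simp add: sum_if_less)
    have "(\<Sum>i<m. (c i + q) ^ a) = (\<Sum>i<m. if i < j then 1 else r)"
      by (intro sum.cong) (auto simp: c_def a n)
    then show "t \<le> (\<Sum>i<m. (c i + q) ^ a)" using j by (simp add: sum_if_less)
  qed
qed

lemma sum_set_eq_interval:
  assumes m1: "((1 - r) / r) ^ a * (Q + 1) \<le> m" and m2: "((1 - r) / r) ^ (a + 1) \<le> m"
    and n: "a = 1 \<Longrightarrow> n = 1"
  shows "sum_set a b m = {0..real m}"
proof
  have "{r ^ a * real m..m} \<subseteq> sum_set a b m"
  proof (cases "a = 1")
    case True
    then show ?thesis using top_interval_of_linear n m1 m2 by (simp add: numeral_2_eq_2)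
  next
    case False
    then have "2 \<le> a" using a_pos by simp
    then show ?thesis
      using top_interval_of_small_ratio top_interval_of_large_ratio m1 by (cases "r \<le> 9 / 25") auto
  qed
  moreover have "0 < r ^ a" "r ^ a < 1"
    using r_pos r_less_half a_pos by (auto intro: power_Suc_less_one simp: power_less_one_iff)
  moreover have "0 \<in> sum_set a b m"
    using sum_set_replicate[OF zero_in_prod_set[OF a_pos], of m] by simp
  ultimately show "{0..real m} \<subseteq> sum_set a b m"
    using sum_set_scale by (intro Icc_subset_of_scaling[of "r ^ a"]) auto
qed (rule sum_set_subset)

end

section \<open>The middle Cantor set as a self-similar set, and the theorem\<close>

lemma cantor_level_0: "cantor_level r 0 = {0..1}"
  by (auto simp: cantor_level_def basic_intervals_def cword_def)

lemma cantor_level_Suc: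
  "cantor_level r (Suc n) = cmap r False ` cantor_level r n \<union> cmap r True ` cantor_level r n"
proof -
  have "cantor_level r n = (\<Union>\<omega>\<in>{\<omega>. length \<omega> = n}. cword r \<omega> ` {0..1})" for n
    by (auto simp: cantor_level_def basic_intervals_def)
  moreover have "{\<omega>. length \<omega> = Suc n} = (\<Union>\<sigma>\<in>(UNIV :: bool set). Cons \<sigma> ` {\<omega>. length \<omega> = n})"
    by (auto simp: length_Suc_conv)
  moreover have "cword r (\<sigma> # \<omega>) = cmap r \<sigma> \<circ> cword r \<omega>" for \<sigma> \<omega>
    by (simp add: cword_def)
  ultimately show ?thesis by (simp add: UNIV_bool image_UN image_comp Un_commute)
qed

lemma compact_cantor_level: "compact (cantor_level r n)"
proof (induction n)
  case (Suc n)
  have "continuous_on S (cmap r \<sigma>)" for S \<sigma>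
    unfolding cmap_def by (cases \<sigma>) (auto intro!: continuous_intros)
  then show ?case using Suc by (auto simp: cantor_level_Suc intro!: compact_Un compact_continuous_image)
qed (simp add: cantor_level_0)

lemma self_similar_set_cantor_set:
  assumes "1 < \<alpha>"
  shows "self_similar_set (cantor_ratio \<alpha>) (cantor_set \<alpha>)"
proof -
  define r where "r = cantor_ratio \<alpha>"
  have r: "0 < r" "r < 1 / 2" using assms by (auto simp: r_def cantor_ratio_def)
  have C: "cantor_set \<alpha> = (\<Inter>n. cantor_level r (Suc n))"
  proof -
    have "{1..} = range Suc" by (auto simp: image_iff) (metis Suc_le_D)
    then show ?thesis by (simp add: cantor_set_def r_def)
  qed
  have unit: "cmap r \<sigma> x \<in> {0..1}" if "x \<in> {0..1}" for x \<sigma>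
  proof -
    define y where "y = r * x"
    have "0 \<le> y" "y \<le> r" using that r by (auto simp: y_def mult_left_le)
    then show ?thesis using r by (auto simp: cmap_def simp flip: y_def)
  qed
  have level: "cantor_level r n \<subseteq> {0..1}" for n
    by (induction n) (use unit in \<open>auto simp: cantor_level_0 cantor_level_Suc\<close>)
  \<comment> \<open>The intersection starts at level 1; membership at level 0 comes from level 1
    lying in [0, 1].\<close>
  have C_level: "x \<in> cantor_level r n" if "x \<in> cantor_set \<alpha>" for x n
    using that level[of "Suc 0"] by (cases n) (auto simp: C cantor_level_0 subset_iff)
  have ends: "0 \<in> cantor_level r n \<and> 1 \<in> cantor_level r n" for n
  proof (induction n)
    case (Suc n)
    have "cmap r False 0 = 0" "cmap r True 1 = 1" by (auto simp: cmap_def)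
    then show ?case using Suc unfolding cantor_level_Suc by (metis UnI1 UnI2 imageI)
  qed (simp add: cantor_level_0)
  have branch: "cmap r \<sigma> x \<in> cantor_set \<alpha>" if "x \<in> cantor_set \<alpha>" for x \<sigma>
    unfolding C using C_level[OF that] by (cases \<sigma>) (auto simp: cantor_level_Suc)
  show ?thesis
  proof
    show "closed (cantor_set \<alpha>)"
      unfolding C using compact_cantor_level compact_imp_closed by blast
    show "cantor_set \<alpha> \<subseteq> {0..1}" using C_level[of _ 0] by (auto simp: cantor_level_0)
    show "0 \<in> cantor_set \<alpha>" "1 \<in> cantor_set \<alpha>" using ends by (auto simp: C)
    show "cantor_ratio \<alpha> * z \<in> cantor_set \<alpha>" if "z \<in> cantor_set \<alpha>" for z
      using branch[OF that, of False] by (simp add: cmap_def r_def)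
    show "cantor_ratio \<alpha> * z + 1 - cantor_ratio \<alpha> \<in> cantor_set \<alpha>" if "z \<in> cantor_set \<alpha>" for z
      using branch[OF that, of True] by (simp add: cmap_def r_def)
  qed (use r in \<open>auto simp: r_def\<close>)
qed

text \<open>r^(-log_r c) = 1 / c, and rounding the exponent down enlarges the power since r < 1; the
  added 1 in the exponent costs the factor r.\<close>

lemma le_power_floor_log:
  fixes r c :: real
  assumes r: "0 < r" "r < 1" and c: "1 \<le> c"
  shows "r \<le> c * r ^ nat (\<lfloor>- log r c\<rfloor> + 1)"
proof -
  have "ln r < 0" "0 \<le> ln c" using assms by auto
  then have "0 \<le> - log r c" by (simp add: log_def divide_nonneg_neg)
  then obtain d where d: "\<lfloor>- log r c\<rfloor> = int d" by (metis zero_le_floor nonneg_int_cases)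
  then have "real d \<le> - log r c" by linarith
  then have "r powr (- log r c) \<le> r powr (real d)" using r by (intro powr_mono') auto
  then have "inverse c \<le> r ^ d" using r c by (simp add: powr_minus powr_log_cancel powr_realpow)
  then have "r * 1 \<le> r * (c * r ^ d)" using c r by (simp add: field_simps)
  then show ?thesis by (simp add: d nat_add_distrib mult_ac)
qed

lemma (in self_similar_set) paired_sums_eq_sum_set:
  "{(\<Sum>i<m. x (2 * i) ^ a * x (2 * i + 1) ^ b) | x :: nat \<Rightarrow> real. \<forall>j < 2 * m. x j \<in> C} = sum_set a b m"
proof
  show "{(\<Sum>i<m. x (2 * i) ^ a * x (2 * i + 1) ^ b) | x. \<forall>j < 2 * m. x j \<in> C} \<subseteq> sum_set a b m"
  proof clarify
    fix x :: "nat \<Rightarrow> real" assume "\<forall>j < 2 * m. x j \<in> C"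
    then have "x (2 * i) \<in> C" "x (2 * i + 1) \<in> C" if "i < m" for i using that by auto
    then show "(\<Sum>i<m. x (2 * i) ^ a * x (2 * i + 1) ^ b) \<in> sum_set a b m"
      by (intro sum_setI) (auto simp: prod_set_def)
  qed
  show "sum_set a b m \<subseteq> {(\<Sum>i<m. x (2 * i) ^ a * x (2 * i + 1) ^ b) | x. \<forall>j < 2 * m. x j \<in> C}"
  proof
    fix t assume "t \<in> sum_set a b m"
    then obtain v where v: "\<forall>i<m. v i \<in> prod_set a b" "t = (\<Sum>i<m. v i)"
      by (auto simp: sum_set_def)
    then have "\<forall>i. \<exists>y z. i < m \<longrightarrow> v i = y ^ a * z ^ b \<and> y \<in> C \<and> z \<in> C"
      by (auto simp: prod_set_def)
    then obtain y z where yz: "\<And>i. i < m \<Longrightarrow> v i = y i ^ a * z i ^ b \<and> y i \<in> C \<and> z i \<in> C"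
      by metis
    define x where "x j = (if even j then y (j div 2) else z (j div 2))" for j
    have "\<forall>j < 2 * m. x j \<in> C" using yz by (auto simp: x_def less_mult_imp_div_less mult.commute)
    moreover have "t = (\<Sum>i<m. x (2 * i) ^ a * x (2 * i + 1) ^ b)"
      unfolding v(2) using yz by (intro sum.cong) (auto simp: x_def)
    ultimately show "t \<in> {(\<Sum>i<m. x (2 * i) ^ a * x (2 * i + 1) ^ b) | x. \<forall>j < 2 * m. x j \<in> C}"
      by blast
  qed
qed

theorem mainTheorem2:
  fixes \<alpha> :: real and a b k :: nat
  assumes "\<alpha> > 1"
    and "a > 0" and "b > 0" and "a \<le> b" and "a + b \<ge> 2"
    and "k > 0" and "even k"
    and "real k \<ge> (let r = cantor_ratio \<alpha>; s = a + b;
                     nstar = nat (\<lfloor>- log r (real a)\<rfloor> + 1);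
                     q = r ^ nstar
                 in max (max
                   (real_of_int \<lceil>2 * ((1 - r + q) ^ (a - 1) * (real b * (1 - r + q) + real a))
                        / ((1 - r) ^ (a - 1) * (1 - q) ^ (b - 1) * (real b * (1 - r) + real a * (1 - q))) + 2\<rceil>
                      * ((1 - r) / r) ^ a)
                   (2 * ((1 - r) / r) ^ (a + 1)))
                   (2 * (1 / (1 - r)) ^ (s - 1) + 2))"
  shows "{0 .. real k / 2} =
    {(\<Sum>i < k div 2. x (2 * i) ^ a * x (2 * i + 1) ^ b) | x :: nat \<Rightarrow> real.
        \<forall>j < k. x j \<in> cantor_set \<alpha>}"
proof -
  define r where "r = cantor_ratio \<alpha>"
  define n where "n = nat (\<lfloor>- log r (real a)\<rfloor> + 1)"
  interpret self_similar_set r "cantor_set \<alpha>"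
    unfolding r_def by (rule self_similar_set_cantor_set) fact
  have "ln r < 0" "0 \<le> ln (real a)" using r_pos r_less_half assms(2) by auto
  then have "0 \<le> - log r a" by (simp add: log_def divide_nonneg_neg)
  then have "0 < n" by (simp add: n_def)
  moreover have "r \<le> a * r ^ n"
    unfolding n_def using r_pos r_less_half assms(2) by (intro le_power_floor_log) auto
  ultimately interpret cantor_products r "cantor_set \<alpha>" a b n
    using assms(2,4) by unfold_locales auto
  obtain m where m: "k = 2 * m" using assms(7) by blast
  define A where "A = ((1 - r) / r) ^ a"
  have "0 \<le> A" using r_pos r_less_half by (simp add: A_def)
  \<comment> \<open>The ceiling is bounded below by its argument; dividing by 2 then turns the bound
    on k = 2 m into (Q + 1) A <= m.\<close>
  have "2 * Q + 2 \<le> \<lceil>2 * Q + 2\<rceil>" by simp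
  then have "(2 * Q + 2) * A \<le> \<lceil>2 * Q + 2\<rceil> * A" using \<open>0 \<le> A\<close> by (rule mult_right_mono)
  moreover have "max (max (\<lceil>2 * Q + 2\<rceil> * A) (2 * ((1 - r) / r) ^ (a + 1)))
      (2 * (1 / (1 - r)) ^ (a + b - 1) + 2) \<le> k"
    using assms(8)
    unfolding Let_def Q_def slope_ratio_def max_slope_def min_slope_def A_def times_divide_eq_right
    unfolding n_def r_def .
  then have "\<lceil>2 * Q + 2\<rceil> * A \<le> k" and m2: "2 * ((1 - r) / r) ^ (a + 1) \<le> k"
    by simp_all
  ultimately have "((1 - r) / r) ^ a * (Q + 1) \<le> m"
    by (simp add: m A_def[symmetric] algebra_simps)
  moreover have "((1 - r) / r) ^ (a + 1) \<le> m" using m2 by (simp add: m)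
  \<comment> \<open>The logarithm of 1 vanishes, so n_* = 1 and q = r, as the linear case
    requires.\<close>
  moreover have "n = 1" if "a = 1" using that by (simp add: n_def)
  ultimately have "sum_set a b m = {0..real m}" by (rule sum_set_eq_interval)
  then show ?thesis using paired_sums_eq_sum_set[where m = m] by (simp add: m)
qed

end
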